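(* Let $\beta>0$, let $\varphi\in\Im$ be strictly increasing on $[0,\beta]$, and let $\Phi(x)=\int_0^x\varphi(t)\,dt$ for $x\ge 0$. If $S_n\subset C([a,b])$ is a 1-space, then for every $f\in C([a,b])$ the best approximation set $\mu_\Phi(f/S_n)$ is a singleton.
   Context: All functions are real-valued and measure is Lebesgue measure on the compact interval $[a,b]$; $|A|$ denotes the Lebesgue measure of a set $A$. $\Im$ is the class of all non-decreasing functions $\varphi$ defined for all real $t\ge 0$ with $\varphi(t)>0$ for $t>0$. It is assumed throughout that $\Phi$ satisfies the $\Delta_2$ condition: there is a constant $\Lambda>0$ with $\Phi(2x)\le\Lambda\Phi(x)$ for all $x\ge0$. $\mu_\Phi(f/S_n)$ is the set of all $P\in S_n$ with $\int_a^b\Phi(|f-P|)\,dx=\inf_{Q\in S_n}\int_a^b\Phi(|f-Q|)\,dx$. An $n$-dimensional linear space $S_n\subset C([a,b])$ is a 1-space if there exists $h\in S_n$ with $h(x)>0$ for every $x\in[a,b]$, and whenever $P_1,P_2\in S_n$ with $P_1\ne P_2$ one has $|\{x\in[a,b]:P_1(x)=P_2(x)\}|=0$. *)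

theory Defs
  imports "HOL-Analysis.Analysis" "HOL-Library.Function_Algebras"
begin

global_interpretation real_fun: vector_space "\<lambda>(c::real) (f::real \<Rightarrow> real) x. c * f x"
  by unfold_locales (auto simp: fun_eq_iff algebra_simps)

text \<open>
  The space \<open>C([a,b])\<close>. HOL functions are total, so an element of \<open>C([a,b])\<close> is represented by its
  extension by zero. Hence equality of representatives is equality on \<open>[a,b]\<close>, and the
  pointwise vector space operations of \<open>real \<Rightarrow> real\<close> restrict to this set.
\<close>

definition C_on :: "real \<Rightarrow> real \<Rightarrow> (real \<Rightarrow> real) set" where
  "C_on a b = {f. continuous_on {a..b} f \<and> (\<forall>x. x \<notin> {a..b} \<longrightarrow> f x = 0)}"

lemma subspace_C_on: "real_fun.subspace (C_on a b)"
  by (auto simp: real_fun.subspace_def C_on_def intro!: continuous_intros)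

definition n_dim_subspace :: "nat \<Rightarrow> (real \<Rightarrow> real) set \<Rightarrow> bool" where
  "n_dim_subspace n S \<longleftrightarrow>
     (\<exists>B. finite B \<and> card B = n \<and> real_fun.independent B \<and> real_fun.span B = S)"

definition one_space :: "real \<Rightarrow> real \<Rightarrow> nat \<Rightarrow> (real \<Rightarrow> real) set \<Rightarrow> bool" where
  "one_space a b n S \<longleftrightarrow>
     S \<subseteq> C_on a b \<and> n_dim_subspace n S \<and>
     (\<exists>h\<in>S. \<forall>x\<in>{a..b}. h x > 0) \<and>
     (\<forall>P1\<in>S. \<forall>P2\<in>S. P1 \<noteq> P2 \<longrightarrow> emeasure lebesgue {x\<in>{a..b}. P1 x = P2 x} = 0)"

text \<open>
  The class of non-decreasing functions on \<open>[0,\<infinity>)\<close> that are positive on \<open>(0,\<infinity>)\<close>;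
  values at negative arguments are irrelevant.
\<close>

definition class_Im :: "(real \<Rightarrow> real) set" where
  "class_Im = {\<phi>. mono_on {0..} \<phi> \<and> (\<forall>t>0. \<phi> t > 0)}"

definition Delta2 :: "(real \<Rightarrow> real) \<Rightarrow> bool" where
  "Delta2 \<Phi> \<longleftrightarrow> (\<exists>\<Lambda>>0. \<forall>x\<ge>0. \<Phi> (2 * x) \<le> \<Lambda> * \<Phi> x)"

definition Phi_error ::
    "(real \<Rightarrow> real) \<Rightarrow> real \<Rightarrow> real \<Rightarrow> (real \<Rightarrow> real) \<Rightarrow> (real \<Rightarrow> real) \<Rightarrow> real" where
  "Phi_error \<Phi> a b f P = (LINT x:{a..b}|lebesgue. \<Phi> \<bar>f x - P x\<bar>)"

definition best_approx ::
    "(real \<Rightarrow> real) \<Rightarrow> real \<Rightarrow> real \<Rightarrow> (real \<Rightarrow> real) \<Rightarrow> (real \<Rightarrow> real) set \<Rightarrow> (real \<Rightarrow> real) set" where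
  "best_approx \<Phi> a b f S =
     {P \<in> S. Phi_error \<Phi> a b f P = (INF Q\<in>S. Phi_error \<Phi> a b f Q)}"

end

theory Submission
  imports Defs
begin

text \<open>
  Write \<open>\<psi> u = \<Phi> \<bar>u\<bar>\<close>. Since \<open>\<phi>\<close> is non-decreasing, \<open>\<psi>\<close> is convex on the whole line, and the odd
  extension of \<open>\<phi>\<close> supplies the slopes of its supporting lines. The strict monotonicity of \<open>\<phi>\<close> on
  \<open>[0,\<beta>]\<close> makes \<open>\<psi>\<close> strictly convex at every point of \<open>(-\<beta>,\<beta>)\<close>; further out \<open>\<psi>\<close> may be affine, so
  strict convexity alone does not give uniqueness.

  Existence: \<open>\<psi>\<close> grows at least linearly, and on a finite-dimensional space the \<open>L\<^sup>1\<close> norm dominates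
  the coefficients with respect to a basis (\<open>L1_norm_lower_bound\<close>). The error is therefore a
  continuous coercive function of finitely many coefficients (\<open>minimizer_exists\<close>).

  Uniqueness (\<open>minimizer_unique\<close>): let \<open>P1 \<noteq> P2\<close> be best approximations and \<open>P\<close> their midpoint. By
  convexity \<open>P\<close> is also best, and the midpoint inequality for \<open>\<psi>\<close> is an equality at every point. By
  strict convexity near \<open>0\<close>, \<open>\<bar>f - P\<bar> \<ge> \<beta>\<close> wherever \<open>P1\<close> and \<open>P2\<close> differ. They differ almost
  everywhere, so continuity gives \<open>\<bar>f - P\<bar> \<ge> \<beta>\<close> on all of \<open>[a,b]\<close>, and \<open>f - P\<close> has constant sign there.
  Moving \<open>P\<close> towards \<open>f\<close> by a small multiple of the positive function \<open>h\<close> of the 1-space then decreases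
  \<open>\<bar>f - P\<bar>\<close> everywhere, which contradicts the minimality of \<open>P\<close>.
\<close>

section \<open>Convexity through supporting lines\<close>

text \<open>
  Convexity is used through supporting lines because \<open>\<psi>\<close> is given as an integral: a bound for the
  integrand on an interval is exactly a supporting line, and \<open>g\<close> carries the information where
  convexity is strict.
\<close>

definition subgradient :: "(real \<Rightarrow> real) \<Rightarrow> (real \<Rightarrow> real) \<Rightarrow> bool" where
  "subgradient g \<psi> \<longleftrightarrow> (\<forall>u v. \<psi> u + g u * (v - u) \<le> \<psi> v)"

lemma subgradientD: "subgradient g \<psi> \<Longrightarrow> \<psi> u + g u * (v - u) \<le> \<psi> v"
  by (simp add: subgradient_def)

lemma subgradient_imp_convex_on:
  assumes "subgradient g \<psi>"
  shows "convex_on UNIV \<psi>"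
proof (rule convex_onI)
  fix t x y :: real
  assume t: "0 < t" "t < 1"
  let ?w = "(1 - t) *\<^sub>R x + t *\<^sub>R y"
  have "(1 - t) * (\<psi> ?w + g ?w * (x - ?w)) + t * (\<psi> ?w + g ?w * (y - ?w))
        \<le> (1 - t) * \<psi> x + t * \<psi> y"
    using t by (intro add_mono mult_left_mono subgradientD[OF assms]) auto
  then show "\<psi> ?w \<le> (1 - t) * \<psi> x + t * \<psi> y"
    by (simp add: algebra_simps)
qed simp

lemma subgradient_imp_continuous_on:
  assumes "subgradient g \<psi>"
  shows "continuous_on T \<psi>"
  using convex_on_continuous[OF open_UNIV subgradient_imp_convex_on[OF assms]]
    continuous_on_subset by blast

lemma subgradient_midpoint:
  assumes "subgradient g \<psi>"
  shows "\<psi> ((u + v) / 2) \<le> (\<psi> u + \<psi> v) / 2"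
  using subgradientD[OF assms, of "(u + v) / 2" u] subgradientD[OF assms, of "(u + v) / 2" v]
  by (simp add: field_simps)

text \<open>
  Only the midpoint has to lie in the interval where \<open>g\<close> increases strictly: just to the right of the
  midpoint the slope exceeds the slope at the midpoint, and from there on \<open>\<psi>\<close> stays above a line that
  is strictly steeper than the supporting line at the midpoint.
\<close>

lemma subgradient_midpoint_strict:
  assumes sg: "subgradient g \<psi>"
    and mono: "strict_mono_on {-\<beta><..<\<beta>} g"
    and mid: "\<bar>(u + v) / 2\<bar> < \<beta>" and "u \<noteq> v"
  shows "\<psi> ((u + v) / 2) < (\<psi> u + \<psi> v) / 2"
proof -
  have *: "\<psi> ((u + v) / 2) < (\<psi> u + \<psi> v) / 2"
    if "u < v" and mid: "\<bar>(u + v) / 2\<bar> < \<beta>" for u v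
  proof -
    define w where "w = (u + v) / 2"
    have "w < min v \<beta>"
      using that by (simp add: w_def field_simps)
    then obtain t where t: "w < t" "t < min v \<beta>"
      using dense by blast
    have "g w < g t"
      using mid t by (intro strict_mono_onD[OF mono]) (auto simp: w_def)
    then have "g w * (v - t) < g t * (v - t)"
      using t by simp
    moreover have "\<psi> w + g w * (t - w) \<le> \<psi> t" "\<psi> t + g t * (v - t) \<le> \<psi> v"
      "\<psi> w + g w * (u - w) \<le> \<psi> u"
      by (intro subgradientD[OF sg])+
    ultimately have "2 * \<psi> w + g w * (u + v - 2 * w) < \<psi> u + \<psi> v"
      by (simp add: algebra_simps)
    moreover have "u + v - 2 * w = 0"
      by (simp add: w_def)
    ultimately have "2 * \<psi> w < \<psi> u + \<psi> v"
      by simp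
    then show ?thesis
      by (simp add: w_def)
  qed
  show ?thesis
    using *[of u v] *[of v u] assms by (cases "u < v") (auto simp: add.commute)
qed

section \<open>The primitive of a function of the class\<close>

text \<open>
  At \<open>u \<noteq> 0\<close> this is the derivative of \<open>\<lambda>u. \<Phi> \<bar>u\<bar>\<close> if \<open>\<phi>\<close> is continuous at \<open>\<bar>u\<bar>\<close>. If \<open>\<phi>\<close> has a positive limit at \<open>0\<close>,
  then \<open>\<lambda>u. \<Phi> \<bar>u\<bar>\<close> has a corner there; since \<open>sgn 0 = 0\<close>, the slope chosen at the corner is that of
  the horizontal line through its minimum.
\<close>

definition odd_extension :: "(real \<Rightarrow> real) \<Rightarrow> real \<Rightarrow> real" where
  "odd_extension \<phi> u = sgn u * \<phi> \<bar>u\<bar>"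

lemma strict_mono_on_odd_extension:
  assumes "\<phi> \<in> class_Im" "strict_mono_on {0..\<beta>} \<phi>"
  shows "strict_mono_on {-\<beta><..<\<beta>} (odd_extension \<phi>)"
proof (rule strict_mono_onI)
  fix u v assume uv: "u \<in> {-\<beta><..<\<beta>}" "v \<in> {-\<beta><..<\<beta>}" "u < v"
  have pos: "\<phi> t > 0" if "t > 0" for t
    using assms that by (simp add: class_Im_def)
  consider "0 < u" | "v < 0" | "u < 0 \<and> 0 \<le> v" | "u = 0"
    using uv by linarith
  then show "odd_extension \<phi> u < odd_extension \<phi> v"
  proof cases
    case 1 then show ?thesis
      using uv strict_mono_onD[OF assms(2), of u v] by (simp add: odd_extension_def)
  next
    case 2 then show ?thesis
      using uv strict_mono_onD[OF assms(2), of "-v" "-u"] by (simp add: odd_extension_def)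
  next
    case 3
    then have "\<phi> (-u) > 0" "v = 0 \<or> \<phi> v > 0"
      using pos[of v] pos[of "-u"] by force+
    with 3 show ?thesis
      by (auto simp: odd_extension_def sgn_if)
  next
    case 4 then show ?thesis
      using uv pos[of v] by (simp add: odd_extension_def)
  qed
qed

context
  fixes \<phi> \<Phi> :: "real \<Rightarrow> real"
  assumes Im: "\<phi> \<in> class_Im"
    and primitive: "\<And>x. x \<ge> 0 \<Longrightarrow> \<Phi> x = (LINT t:{0..x}|lebesgue. \<phi> t)"
begin

lemma class_Im_mono: "0 \<le> s \<Longrightarrow> s \<le> t \<Longrightarrow> \<phi> s \<le> \<phi> t"
  using Im by (auto simp: class_Im_def mono_on_def)

lemma class_Im_pos: "0 < t \<Longrightarrow> 0 < \<phi> t"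
  using Im by (simp add: class_Im_def)

lemma class_Im_integrable: "0 \<le> s \<Longrightarrow> \<phi> integrable_on {s..t}"
  by (intro integrable_on_mono_on mono_onI class_Im_mono) auto

lemma primitive_eq_integral:
  assumes "0 \<le> x"
  shows "\<Phi> x = integral {0..x} \<phi>"
proof -
  have "\<phi> absolutely_integrable_on {0..x}"
  proof (rule absolutely_integrable_integrable_bound)
    fix t assume "t \<in> {0..x}"
    then show "norm (\<phi> t) \<le> max \<bar>\<phi> 0\<bar> \<bar>\<phi> x\<bar>"
      using class_Im_mono[of 0 t] class_Im_mono[of t x] by auto
  qed (use class_Im_integrable in auto)
  then show ?thesis
    using primitive[OF assms] set_lebesgue_integral_eq_integral(2) by metis
qed

lemma primitive_diff:
  assumes "0 \<le> x" "x \<le> y"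
  shows "\<Phi> y - \<Phi> x = integral {x..y} \<phi>"
  using Henstock_Kurzweil_Integration.integral_combine[OF assms class_Im_integrable] assms
  by (simp add: primitive_eq_integral)

lemma primitive_tangent:
  assumes "0 < u" "0 \<le> v"
  shows "\<Phi> u + \<phi> u * (v - u) \<le> \<Phi> v"
proof (cases "u \<le> v")
  case True
  have "integral {u..v} (\<lambda>_. \<phi> u) \<le> integral {u..v} \<phi>"
    by (intro integral_le class_Im_integrable) (use assms class_Im_mono in auto)
  with True assms show ?thesis
    using primitive_diff[of u v] by (simp add: mult.commute)
next
  case False
  have "integral {v..u} \<phi> \<le> integral {v..u} (\<lambda>_. \<phi> u)"
    by (intro integral_le class_Im_integrable) (use assms class_Im_mono in auto)
  with False assms show ?thesis
    using primitive_diff[of v u] by (simp add: algebra_simps)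
qed

text \<open>
  The proof passes through the midpoint and treats the left half on an open interval, because at
  \<open>x = 0\<close> the class prescribes neither a sign nor a supporting line: \<open>\<phi> 0\<close> may be negative.
\<close>

lemma primitive_strict_mono:
  assumes "0 \<le> x" "x < y"
  shows "\<Phi> x < \<Phi> y"
proof -
  define z where "z = (x + y) / 2"
  have z: "0 < z" "x < z" "z < y" using assms by (auto simp: z_def)
  have "\<Phi> z < \<Phi> z + \<phi> z * (y - z)"
    using z class_Im_pos[of z] by simp
  also have "\<dots> \<le> \<Phi> y"
    using z by (intro primitive_tangent) auto
  finally have "\<Phi> z < \<Phi> y" .
  moreover have "\<Phi> x \<le> \<Phi> z"
  proof -
    have "integral {x..z} \<phi> = integral {x<..<z} \<phi>"
      by (rule integral_open_interval_real)
    also have "\<dots> \<ge> 0"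
      using assms class_Im_pos
      by (intro integral_nonneg integrable_on_open_interval_real[THEN iffD2] class_Im_integrable)
        (auto intro: less_imp_le)
    finally show ?thesis
      using primitive_diff[of x z] z assms by simp
  qed
  ultimately show ?thesis by simp
qed

lemma subgradient_primitive_abs: "subgradient (odd_extension \<phi>) (\<lambda>u. \<Phi> \<bar>u\<bar>)"
  unfolding subgradient_def
proof (intro allI)
  fix u v :: real
  show "\<Phi> \<bar>u\<bar> + odd_extension \<phi> u * (v - u) \<le> \<Phi> \<bar>v\<bar>"
  proof (cases "u = 0")
    case True
    then show ?thesis
      using primitive_strict_mono[of 0 "\<bar>v\<bar>"] by (cases "v = 0") (auto simp: odd_extension_def)
  next
    case False
    have "sgn u * (v - u) \<le> \<bar>v\<bar> - \<bar>u\<bar>"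
      by (auto simp: sgn_if)
    then have "\<phi> \<bar>u\<bar> * (sgn u * (v - u)) \<le> \<phi> \<bar>u\<bar> * (\<bar>v\<bar> - \<bar>u\<bar>)"
      using False class_Im_pos[of "\<bar>u\<bar>"] by (intro mult_left_mono) auto
    with primitive_tangent[of "\<bar>u\<bar>" "\<bar>v\<bar>"] False show ?thesis
      by (simp add: odd_extension_def mult_ac)
  qed
qed

text \<open>The supporting line at \<open>1\<close> has positive slope, which makes the error coercive.\<close>

lemma primitive_linear_growth: "\<phi> 1 * \<bar>u\<bar> - \<phi> 1 \<le> \<Phi> \<bar>u\<bar>"
proof -
  have "\<Phi> 0 = 0"
    by (simp add: primitive_eq_integral)
  then have "0 \<le> \<Phi> 1" using primitive_strict_mono[of 0 1] by simp
  with primitive_tangent[of 1 "\<bar>u\<bar>"] show ?thesis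
    by (simp add: algebra_simps)
qed

end

section \<open>Existence in finite-dimensional subspaces\<close>

text \<open>
  Coefficient families are total functions on \<open>real \<Rightarrow> real\<close> with the product topology, so a single
  type serves all bases and all dimensions. Compactness is recovered by requiring the coefficients
  outside the basis to vanish.
\<close>

definition lincomb :: "(real \<Rightarrow> real) set \<Rightarrow> ((real \<Rightarrow> real) \<Rightarrow> real) \<Rightarrow> real \<Rightarrow> real" where
  "lincomb B c x = (\<Sum>v\<in>B. c v * v x)"

lemma lincomb_eq_sum: "(\<Sum>v\<in>B. (\<lambda>x. c v * v x)) = lincomb B c"
proof -
  have "(\<Sum>v\<in>B. (\<lambda>x. c v * v x)) x = (\<Sum>v\<in>B. c v * v x)" for x
    by (induction B rule: infinite_finite_induct) auto
  then show ?thesis by (auto simp: lincomb_def)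
qed

lemma span_eq_range_lincomb: "finite B \<Longrightarrow> real_fun.span B = range (lincomb B)"
  by (simp add: real_fun.span_finite lincomb_eq_sum)

lemma continuous_on_lincomb_joint:
  assumes "B \<subseteq> C_on a b"
  shows "continuous_on (K \<times> {a..b}) (\<lambda>(c, x). lincomb B c x)"
proof -
  have "continuous_on (K \<times> {a..b}) (\<lambda>p. fst p v * v (snd p))" if "v \<in> B" for v
  proof (rule continuous_on_mult)
    show "continuous_on (K \<times> {a..b}) (\<lambda>p. fst p v)"
      by (rule continuous_on_product_then_coordinatewise[OF continuous_on_fst[OF continuous_on_id]])
    have "continuous_on {a..b} v"
      using assms that by (auto simp: C_on_def)
    then show "continuous_on (K \<times> {a..b}) (\<lambda>p. v (snd p))"
      by (rule continuous_on_compose2[OF _ continuous_on_snd[OF continuous_on_id]]) auto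
  qed
  then show ?thesis
    unfolding lincomb_def case_prod_beta by (intro continuous_on_sum) simp
qed

lemma continuous_on_lincomb:
  assumes "B \<subseteq> C_on a b"
  shows "continuous_on {a..b} (lincomb B c)"
  unfolding lincomb_def using assms by (intro continuous_intros) (auto simp: C_on_def)

lemma compact_coefficient_box:
  "compact {c :: 'a \<Rightarrow> real. \<forall>v. c v \<in> (if v \<in> B then {-r..r} else {0})}"
proof -
  have "compactin (product_topology (\<lambda>v. euclidean) UNIV)
          (PiE UNIV (\<lambda>v::'a. if v \<in> B then {-r..r::real} else {0}))"
    by (subst compactin_PiE) auto
  then show ?thesis
    by (simp add: euclidean_product_topology PiE_UNIV_domain Pi_def)
qed

text \<open>
  The \<open>L\<^sup>1\<close> norm of a combination is continuous in its coefficients and attains a minimum on the compact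
  unit sphere of the \<open>l\<^sup>1\<close> norm of coefficients. By linear independence this minimum is positive, and
  homogeneity carries the bound to all coefficients.
\<close>

lemma L1_norm_lower_bound:
  assumes "a < b" "finite B" "B \<subseteq> C_on a b" "real_fun.independent B"
  shows "\<exists>m>0. \<forall>c. m * (\<Sum>v\<in>B. \<bar>c v\<bar>) \<le> integral {a..b} (\<lambda>x. \<bar>lincomb B c x\<bar>)"
proof (cases "B = {}")
  case True
  then show ?thesis by (auto intro!: exI[of _ 1] simp: lincomb_def)
next
  case False
  define N where "N c = integral {a..b} (\<lambda>x. \<bar>lincomb B c x\<bar>)" for c
  define K where "K = {c :: (real \<Rightarrow> real) \<Rightarrow> real. \<forall>v. c v \<in> (if v \<in> B then {-1..1} else {0})}
                      \<inter> {c. (\<Sum>v\<in>B. \<bar>c v\<bar>) = 1}"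
  have cont_N: "continuous_on K N"
    unfolding N_def
    using integral_continuous_on_param[of K a b "\<lambda>c x. \<bar>lincomb B c x\<bar>"]
      continuous_on_rabs[OF continuous_on_lincomb_joint[OF assms(3), of K]]
    by (simp add: case_prod_beta)
  have "closed {c :: (real \<Rightarrow> real) \<Rightarrow> real. (\<Sum>v\<in>B. \<bar>c v\<bar>) = 1}"
    by (intro closed_Collect_eq continuous_intros continuous_on_product_coordinates)
  then have "compact K"
    unfolding K_def by (intro compact_Int_closed compact_coefficient_box)
  have normalize: "(\<lambda>v. if v \<in> B then c v / s else 0) \<in> K"
    if s: "s = (\<Sum>v\<in>B. \<bar>c v\<bar>)" "s > 0" for c s
  proof -
    have "\<bar>c v\<bar> \<le> s" if "v \<in> B" for v
      unfolding s using that assms(2) by (intro member_le_sum) auto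
    moreover have "(\<Sum>v\<in>B. \<bar>c v / s\<bar>) = 1"
      using s by (simp add: sum_divide_distrib[symmetric])
    ultimately show ?thesis
      using s(2) by (fastforce simp: K_def abs_le_iff field_simps)
  qed
  \<comment> \<open>Normalizing the constant family \<open>1\<close> shows that the sphere has a point.\<close>
  have "(\<lambda>v. if v \<in> B then 1 / real (card B) else 0) \<in> K"
    using normalize[of "real (card B)" "\<lambda>_. 1"] False assms(2) by (simp add: card_gt_0_iff)
  then have "K \<noteq> {}" by blast
  then obtain c0 where c0: "c0 \<in> K" "\<And>c. c \<in> K \<Longrightarrow> N c0 \<le> N c"
    using continuous_attains_inf[OF \<open>compact K\<close> _ cont_N] by blast
  have cont: "continuous_on {a..b} (\<lambda>x. \<bar>lincomb B c x\<bar>)" for c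
    by (intro continuous_intros continuous_on_lincomb assms)
  have "N c0 \<noteq> 0"
  proof
    assume "N c0 = 0"
    then have "\<forall>x\<in>{a..b}. lincomb B c0 x = 0"
      using integral_eq_0_iff[OF cont \<open>a < b\<close>] by (simp add: N_def)
    moreover have "lincomb B c0 x = 0" if "x \<notin> {a..b}" for x
      using assms(3) that by (auto simp: lincomb_def C_on_def intro!: sum.neutral)
    ultimately have "lincomb B c0 = 0"
      by (auto simp: fun_eq_iff)
    with lincomb_eq_sum[of c0 B] have "(\<Sum>v\<in>B. (\<lambda>x. c0 v * v x)) = 0"
      by (rule trans)
    then have "\<forall>v\<in>B. c0 v = 0"
      by (intro ballI real_fun.independentD[OF assms(4,2) order_refl, where u = c0])
    then show False
      using c0(1) by (simp add: K_def)
  qed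
  moreover have "0 \<le> N c0"
    unfolding N_def by (intro integral_nonneg integrable_continuous_real cont) auto
  moreover have "N c0 * (\<Sum>v\<in>B. \<bar>c v\<bar>) \<le> N c" for c
  proof (cases "(\<Sum>v\<in>B. \<bar>c v\<bar>) = 0")
    case True
    then show ?thesis
      by (simp add: N_def) (intro integral_nonneg integrable_continuous_real cont, auto)
  next
    case nz: False
    define s where "s = (\<Sum>v\<in>B. \<bar>c v\<bar>)"
    have s: "s > 0" using nz by (simp add: s_def order_le_neq_trans sum_nonneg)
    define c' where "c' v = (if v \<in> B then c v / s else 0)" for v
    have "N c0 \<le> N c'"
      using c0(2) normalize[OF s_def s] by (simp add: c'_def[abs_def])
    moreover have "lincomb B c x = s * lincomb B c' x" for x
      using s unfolding lincomb_def c'_def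
      by (simp add: sum_distrib_left)
    then have "N c = s * N c'"
      using s by (simp add: N_def abs_mult)
    ultimately show ?thesis
      using s by (simp add: s_def[symmetric] mult.commute)
  qed
  ultimately show ?thesis
    unfolding N_def by (intro exI[of _ "N c0"]) (auto simp: N_def)
qed

text \<open>
  By linear growth, \<open>p \<bar>Q\<bar> \<le> \<psi> (f - Q) + p \<bar>f\<bar> + q\<close> at every point. Integration bounds the coefficients
  of every \<open>Q\<close> that is at least as good as \<open>0\<close>, so the search for a minimum is confined to a compact
  box.
\<close>

lemma minimizer_exists:
  assumes "a < b" and S: "n_dim_subspace n S" "S \<subseteq> C_on a b" and f: "continuous_on {a..b} f"
    and \<psi>: "continuous_on UNIV \<psi>" and growth: "p > 0" "\<And>u. p * \<bar>u\<bar> - q \<le> \<psi> u"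
  obtains P where "P \<in> S"
    "\<And>Q. Q \<in> S \<Longrightarrow> integral {a..b} (\<lambda>x. \<psi> (f x - P x)) \<le> integral {a..b} (\<lambda>x. \<psi> (f x - Q x))"
proof -
  obtain B where B: "finite B" "real_fun.independent B" "real_fun.span B = S"
    using S(1) by (auto simp: n_dim_subspace_def)
  have BC: "B \<subseteq> C_on a b"
    using B(3) S(2) real_fun.span_superset by blast
  have S_eq: "S = range (lincomb B)"
    using B by (simp add: span_eq_range_lincomb)
  define E where "E c = integral {a..b} (\<lambda>x. \<psi> (f x - lincomb B c x))" for c
  obtain m where m: "m > 0"
      "\<And>c. m * (\<Sum>v\<in>B. \<bar>c v\<bar>) \<le> integral {a..b} (\<lambda>x. \<bar>lincomb B c x\<bar>)"
    using L1_norm_lower_bound[OF assms(1) B(1) BC B(2)] by blast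
  define F where "F = integral {a..b} (\<lambda>x. p * \<bar>f x\<bar> + q)"
  have coercive: "p * m * (\<Sum>v\<in>B. \<bar>c v\<bar>) \<le> E c + F" for c
  proof -
    note cont = f continuous_on_lincomb[OF BC, of c]
    have cE: "continuous_on {a..b} (\<lambda>x. \<psi> (f x - lincomb B c x))"
      by (intro continuous_on_compose2[OF \<psi>] continuous_intros cont) auto
    have "p * (m * (\<Sum>v\<in>B. \<bar>c v\<bar>)) \<le> p * integral {a..b} (\<lambda>x. \<bar>lincomb B c x\<bar>)"
      using m(2) growth(1) by simp
    also have "\<dots> = integral {a..b} (\<lambda>x. p * \<bar>lincomb B c x\<bar>)"
      by simp
    also have "\<dots> \<le> integral {a..b} (\<lambda>x. \<psi> (f x - lincomb B c x) + (p * \<bar>f x\<bar> + q))"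
    proof (rule integral_le)
      fix x
      have "p * \<bar>lincomb B c x\<bar> \<le> p * (\<bar>f x - lincomb B c x\<bar> + \<bar>f x\<bar>)"
        using growth(1) by (intro mult_left_mono) auto
      also have "\<dots> = p * \<bar>f x - lincomb B c x\<bar> - q + (p * \<bar>f x\<bar> + q)"
        by (simp add: algebra_simps)
      also have "\<dots> \<le> \<psi> (f x - lincomb B c x) + (p * \<bar>f x\<bar> + q)"
        using growth(2)[of "f x - lincomb B c x"] by simp
      finally show "p * \<bar>lincomb B c x\<bar> \<le> \<psi> (f x - lincomb B c x) + (p * \<bar>f x\<bar> + q)" .
    qed (intro integrable_continuous_real continuous_intros cont cE)+
    also have "\<dots> = E c + F"
      unfolding E_def F_def
      by (intro integral_add integrable_continuous_real continuous_intros cont cE)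
    finally show ?thesis by (simp add: mult_ac)
  qed
  \<comment> \<open>The radius is the bound that \<open>coercive\<close> gives for coefficients at least as good as zero.\<close>
  define r where "r = \<bar>E (\<lambda>_. 0) + F\<bar> / (p * m)"
  define K where "K = {c :: (real \<Rightarrow> real) \<Rightarrow> real. \<forall>v. c v \<in> (if v \<in> B then {-r..r} else {0})}"
  have pm: "p * m > 0" and r0: "r \<ge> 0" using m growth by (auto simp: r_def)
  have zero: "(\<lambda>_. 0) \<in> K" using r0 by (auto simp: K_def)
  have "continuous_on (K \<times> {a..b}) (\<lambda>p. f (snd p))"
    by (intro continuous_on_compose2[OF f] continuous_intros) auto
  then have "continuous_on (K \<times> {a..b}) (\<lambda>(c, x). \<psi> (f x - lincomb B c x))"
    using continuous_on_lincomb_joint[OF BC, of K] unfolding case_prod_beta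
    by (intro continuous_on_compose2[OF \<psi>] continuous_intros) auto
  then have "continuous_on K E"
    unfolding E_def using integral_continuous_on_param[of K a b "\<lambda>c x. \<psi> (f x - lincomb B c x)"]
    by simp
  moreover have "compact K"
    unfolding K_def by (rule compact_coefficient_box)
  ultimately obtain c0 where c0: "\<And>c. c \<in> K \<Longrightarrow> E c0 \<le> E c"
    using continuous_attains_inf[of K E] zero by blast
  have "E c0 \<le> E c" for c
  proof (cases "E c \<le> E (\<lambda>_. 0)")
    case True
    define c' where "c' v = (if v \<in> B then c v else 0)" for v
    have "p * m * (\<Sum>v\<in>B. \<bar>c v\<bar>) \<le> \<bar>E (\<lambda>_. 0) + F\<bar>"
      using coercive[of c] True by linarith
    then have le_r: "(\<Sum>v\<in>B. \<bar>c v\<bar>) \<le> r"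
      using pm by (simp add: r_def field_simps)
    have "\<bar>c v\<bar> \<le> r" if "v \<in> B" for v
      using member_le_sum[of v B "\<lambda>v. \<bar>c v\<bar>"] that B(1) le_r by simp
    then have "c' \<in> K"
      by (fastforce simp: K_def c'_def abs_le_iff)
    then have "E c0 \<le> E c'" by (rule c0)
    moreover have "lincomb B c' = lincomb B c"
      by (auto simp: lincomb_def c'_def)
    ultimately show ?thesis by (simp add: E_def)
  next
    case False
    then show ?thesis using c0[OF zero] by simp
  qed
  then show ?thesis
    using that[of "lincomb B c0"] by (auto simp: S_eq E_def)
qed

section \<open>Uniqueness in 1-spaces\<close>

text \<open>
  The hypotheses on \<open>\<psi>\<close> enter separately: strict convexity on \<open>(-\<beta>,\<beta>)\<close> forces the midpoint of two
  minimizers to stay at distance at least \<open>\<beta>\<close> from \<open>f\<close>, and strict growth in \<open>\<bar>u\<bar>\<close> shows that such a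
  one-sided approximation can be improved.
\<close>

lemma minimizer_unique:
  assumes "a < b" "\<beta> > 0" and S: "one_space a b n S" and f: "continuous_on {a..b} f"
    and \<psi>: "subgradient g \<psi>" "strict_mono_on {-\<beta><..<\<beta>} g"
    and mono: "\<And>u v. \<bar>u\<bar> < \<bar>v\<bar> \<Longrightarrow> \<psi> u < \<psi> v"
    and P1: "P1 \<in> S"
      "\<And>Q. Q \<in> S \<Longrightarrow> integral {a..b} (\<lambda>x. \<psi> (f x - P1 x)) \<le> integral {a..b} (\<lambda>x. \<psi> (f x - Q x))"
    and P2: "P2 \<in> S"
      "\<And>Q. Q \<in> S \<Longrightarrow> integral {a..b} (\<lambda>x. \<psi> (f x - P2 x)) \<le> integral {a..b} (\<lambda>x. \<psi> (f x - Q x))"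
  shows "P1 = P2"
proof (rule ccontr)
  assume ne: "P1 \<noteq> P2"
  define E where "E P = integral {a..b} (\<lambda>x. \<psi> (f x - P x))" for P
  have SC: "continuous_on {a..b} P" if "P \<in> S" for P
    using that S by (auto simp: one_space_def C_on_def)
  have cont: "continuous_on {a..b} (\<lambda>x. \<psi> (f x - P x))" if "P \<in> S" for P
    by (intro continuous_on_compose2[OF subgradient_imp_continuous_on[OF \<psi>(1), of UNIV]]
        continuous_intros f SC that subset_UNIV)
  have int: "(\<lambda>x. \<psi> (f x - P x)) integrable_on {a..b}" if "P \<in> S" for P
    by (intro integrable_continuous_real cont that)
  have "real_fun.subspace S"
    using S by (auto simp: one_space_def n_dim_subspace_def)
  then have comb: "(\<lambda>x. s * P x + t * Q x) \<in> S" if "P \<in> S" "Q \<in> S" for s t P Q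
    using real_fun.subspace_add[of S "\<lambda>x. s * P x" "\<lambda>x. t * Q x"] that
    by (simp add: real_fun.subspace_scale plus_fun_def)
  define P where "P x = 1/2 * P1 x + 1/2 * P2 x" for x
  have PS: "P \<in> S"
    unfolding P_def[abs_def] by (rule comb[OF P1(1) P2(1)])
  define u where "u x = f x - P x" for x
  have mid: "u x = ((f x - P1 x) + (f x - P2 x)) / 2" for x
    by (simp add: u_def P_def field_simps)
  have cu: "continuous_on {a..b} u"
    unfolding u_def by (intro continuous_intros f SC PS)
  \<comment> \<open>\<open>d\<close> is the gap in the midpoint inequality; it is nonnegative and continuous.\<close>
  define d where "d x = (\<psi> (f x - P1 x) + \<psi> (f x - P2 x)) / 2 - \<psi> (u x)" for x
  have cd: "continuous_on {a..b} d"
    unfolding d_def u_def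
    by (intro continuous_on_diff continuous_on_divide continuous_on_add continuous_on_const
        cont P1(1) P2(1) PS) auto
  have d0: "0 \<le> d x" for x
    unfolding d_def mid
    using subgradient_midpoint[OF \<psi>(1), of "f x - P1 x" "f x - P2 x"] by linarith
  have d_int: "integral {a..b} d = (E P1 + E P2) / 2 - E P"
    unfolding d_def E_def u_def using int P1(1) P2(1) PS
    by (simp add: integral_diff integral_add integrable_add)
  have d_int_nonneg: "0 \<le> integral {a..b} d"
    by (intro integral_nonneg integrable_continuous_real cd d0)
  have le: "E P1 \<le> E P" "E P2 \<le> E P" "E P1 \<le> E P2" "E P2 \<le> E P1"
    using P1 P2 PS by (auto simp: E_def)
  have EP: "E P \<le> E P1"
    using d_int d_int_nonneg le by argo
  have "integral {a..b} d = 0"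
    using d_int d_int_nonneg le by argo
  then have d_zero: "d x = 0" if "x \<in> {a..b}" for x
    using integral_eq_0_iff[OF cd \<open>a < b\<close> d0] that by auto
  have apart: "\<beta> \<le> \<bar>u x\<bar>" if "x \<in> {a..b}" "P1 x \<noteq> P2 x" for x
  proof (rule ccontr)
    assume "\<not> \<beta> \<le> \<bar>u x\<bar>"
    then have "\<psi> (u x) < (\<psi> (f x - P1 x) + \<psi> (f x - P2 x)) / 2"
      using that unfolding mid by (intro subgradient_midpoint_strict[OF \<psi>]) auto
    then show False
      using d_zero[OF that(1)] by (simp add: d_def)
  qed
  have large: "\<beta> \<le> \<bar>u x0\<bar>" if x0: "x0 \<in> {a..b}" for x0
  proof (rule ccontr)
    assume "\<not> \<beta> \<le> \<bar>u x0\<bar>"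
    then obtain e where e: "e > 0" "\<And>x. x \<in> {a..b} \<Longrightarrow> \<bar>x - x0\<bar> < e \<Longrightarrow> \<bar>u x - u x0\<bar> < \<beta> - \<bar>u x0\<bar>"
      using cu x0 unfolding continuous_on_iff dist_real_def
      by (metis diff_gt_0_iff_gt not_le)
    \<comment> \<open>Near \<open>x0\<close> the functions \<open>P1\<close> and \<open>P2\<close> would agree on a nondegenerate interval; cutting it
      down to \<open>(a,b)\<close> covers the case that \<open>x0\<close> is an endpoint.\<close>
    define I where "I = {max a (x0 - e)<..<min b (x0 + e)}"
    have sub: "I \<subseteq> {x \<in> {a..b}. P1 x = P2 x}"
    proof
      fix x assume "x \<in> I"
      then have x: "x \<in> {a..b}" "\<bar>x - x0\<bar> < e" by (auto simp: I_def)
      then have "\<bar>u x\<bar> < \<beta>" using e(2)[of x] by linarith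
      with apart[of x] x show "x \<in> {x \<in> {a..b}. P1 x = P2 x}" by auto
    qed
    have "emeasure lebesgue {x \<in> {a..b}. P1 x = P2 x} = 0"
      using S P1(1) P2(1) ne by (auto simp: one_space_def)
    moreover have "closed {x \<in> {a..b}. P1 x = P2 x}"
      using continuous_closed_preimage_constant[of "{a..b}" "\<lambda>x. P1 x - P2 x" 0]
        continuous_on_diff[OF SC[OF P1(1)] SC[OF P2(1)]] by simp
    ultimately have "negligible {x \<in> {a..b}. P1 x = P2 x}"
      by (subst negligible_iff_emeasure0) auto
    then have "negligible I"
      using sub negligible_subset by blast
    moreover have "I \<noteq> {}"
      using x0 e(1) \<open>a < b\<close> by (auto simp: I_def)
    ultimately show False
      using open_not_negligible[of I] by (simp add: I_def)
  qed
  have "(\<forall>x\<in>{a..b}. \<beta> \<le> u x) \<or> (\<forall>x\<in>{a..b}. \<beta> \<le> - u x)"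
  proof (rule ccontr)
    assume "\<not> ?thesis"
    then obtain x y where xy: "x \<in> {a..b}" "y \<in> {a..b}" "u x < \<beta>" "- u y < \<beta>" by force
    then have "u x \<le> 0" "0 \<le> u y" using large[of x] large[of y] by linarith+
    moreover have "connected (u ` {a..b})"
      by (intro connected_continuous_image cu connected_Icc)
    ultimately have "0 \<in> u ` {a..b}"
      using xy connectedD_interval[of "u ` {a..b}" "u x" "u y" 0] by blast
    then show False using large \<open>\<beta> > 0\<close> by force
  qed
  then obtain s :: real where s: "s = 1 \<or> s = -1" "\<And>x. x \<in> {a..b} \<Longrightarrow> \<beta> \<le> s * u x"
    by (metis mult_1 mult_minus1)
  obtain h where h: "h \<in> S" "\<And>x. x \<in> {a..b} \<Longrightarrow> h x > 0"
    using S by (auto simp: one_space_def)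
  obtain z where z: "z \<in> {a..b}" "\<And>x. x \<in> {a..b} \<Longrightarrow> h x \<le> h z"
    using continuous_attains_sup[OF compact_Icc _ SC[OF h(1)]] \<open>a < b\<close> by auto
  \<comment> \<open>With this choice \<open>0 < \<epsilon> * h x \<le> \<beta> \<le> \<bar>u x\<bar>\<close>, so the step towards \<open>f\<close> never overshoots.\<close>
  define \<epsilon> where "\<epsilon> = \<beta> / h z"
  have step: "0 < \<epsilon> * h x" "\<epsilon> * h x \<le> \<beta>" if "x \<in> {a..b}" for x
    using h(2)[OF that] h(2)[OF z(1)] z(2)[OF that] \<open>\<beta> > 0\<close> by (auto simp: \<epsilon>_def field_simps)
  define R where "R x = 1 * P x + (s * \<epsilon>) * h x" for x
  have RS: "R \<in> S"
    unfolding R_def[abs_def] by (rule comb[OF PS h(1)])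
  have "\<psi> (f x - R x) < \<psi> (f x - P x)" if "x \<in> {a..b}" for x
  proof (rule mono)
    have "f x - R x = u x - s * (\<epsilon> * h x)" by (simp add: R_def u_def)
    then show "\<bar>f x - R x\<bar> < \<bar>f x - P x\<bar>"
      using s(1) s(2)[OF that] step[OF that] \<open>\<beta> > 0\<close> by (auto simp: u_def[symmetric])
  qed
  then have "E R < E P"
    unfolding E_def using cont[OF RS] cont[OF PS] \<open>a < b\<close>
    by (intro integral_less_real) auto
  with EP P1(2)[OF RS] show False
    by (simp add: E_def)
qed

section \<open>Existence and uniqueness of the best approximation\<close>

lemma Phi_error_eq_integral:
  assumes "continuous_on {a..b} f" "continuous_on {a..b} P" "continuous_on UNIV (\<lambda>u. \<Phi> \<bar>u\<bar>)"
  shows "Phi_error \<Phi> a b f P = integral {a..b} (\<lambda>x. \<Phi> \<bar>f x - P x\<bar>)"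
proof -
  have "continuous_on {a..b} (\<lambda>x. \<Phi> \<bar>f x - P x\<bar>)"
    using continuous_on_compose2[OF assms(3) continuous_on_diff[OF assms(1,2)]] by simp
  then show ?thesis
    unfolding Phi_error_def
    by (intro set_lebesgue_integral_eq_integral absolutely_integrable_continuous_real)
qed

text \<open>
  The infimum of the errors is a conditional one; an attained minimum gives it its intended meaning.
\<close>

lemma best_approx_eq_minimizers:
  assumes "P0 \<in> S" "\<And>Q. Q \<in> S \<Longrightarrow> Phi_error \<Phi> a b f P0 \<le> Phi_error \<Phi> a b f Q"
  shows "best_approx \<Phi> a b f S = {P \<in> S. \<forall>Q\<in>S. Phi_error \<Phi> a b f P \<le> Phi_error \<Phi> a b f Q}"
proof -
  have "(INF Q\<in>S. Phi_error \<Phi> a b f Q) = Phi_error \<Phi> a b f P0"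
    using assms by (intro cInf_eq_minimum) auto
  then show ?thesis
    using assms by (auto simp: best_approx_def intro: antisym)
qed

theorem theorem3p4:
  fixes a b \<beta> :: real and \<phi> \<Phi> :: "real \<Rightarrow> real"
    and n :: nat and S :: "(real \<Rightarrow> real) set"
  assumes "a < b"
    and "\<beta> > 0"
    and "\<phi> \<in> class_Im"
    and "strict_mono_on {0..\<beta>} \<phi>"
    and "\<And>x. x \<ge> 0 \<Longrightarrow> \<Phi> x = (LINT t:{0..x}|lebesgue. \<phi> t)"
    and "Delta2 \<Phi>"
    and "one_space a b n S"
  shows "\<forall>f\<in>C_on a b. is_singleton (best_approx \<Phi> a b f S)"
proof
  fix f assume "f \<in> C_on a b"
  then have f: "continuous_on {a..b} f" by (simp add: C_on_def)
  let ?\<psi> = "\<lambda>u. \<Phi> \<bar>u\<bar>"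
  have S: "n_dim_subspace n S" "S \<subseteq> C_on a b"
    using assms(7) by (auto simp: one_space_def)
  have sg: "subgradient (odd_extension \<phi>) ?\<psi>"
    using subgradient_primitive_abs[OF assms(3,5)] .
  note cont = subgradient_imp_continuous_on[OF sg, of UNIV]
  have err: "Phi_error \<Phi> a b f P = integral {a..b} (\<lambda>x. ?\<psi> (f x - P x))" if "P \<in> S" for P
    using that S(2) by (intro Phi_error_eq_integral f cont) (auto simp: C_on_def)
  have "0 < \<phi> 1"
    using class_Im_pos[OF assms(3,5), of 1] by simp
  then obtain P where P: "P \<in> S" "\<And>Q. Q \<in> S \<Longrightarrow>
      integral {a..b} (\<lambda>x. ?\<psi> (f x - P x)) \<le> integral {a..b} (\<lambda>x. ?\<psi> (f x - Q x))"
    using minimizer_exists[OF assms(1) S f cont _ primitive_linear_growth[OF assms(3,5)]]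
    by metis
  then have P_min: "Phi_error \<Phi> a b f P \<le> Phi_error \<Phi> a b f Q" if "Q \<in> S" for Q
    using err that by simp
  have "P' = P" if P': "P' \<in> S" "\<forall>Q\<in>S. Phi_error \<Phi> a b f P' \<le> Phi_error \<Phi> a b f Q" for P'
  proof (rule minimizer_unique[OF assms(1,2,7) f sg strict_mono_on_odd_extension[OF assms(3,4)]])
    show "?\<psi> u < ?\<psi> v" if "\<bar>u\<bar> < \<bar>v\<bar>" for u v :: real
      using primitive_strict_mono[OF assms(3,5)] that by auto
    show "integral {a..b} (\<lambda>x. ?\<psi> (f x - P' x)) \<le> integral {a..b} (\<lambda>x. ?\<psi> (f x - Q x))"
      if "Q \<in> S" for Q
      using P'(2) err[OF P'(1)] err that by simp
  qed (fact P P'(1))+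
  moreover have "best_approx \<Phi> a b f S
      = {P \<in> S. \<forall>Q\<in>S. Phi_error \<Phi> a b f P \<le> Phi_error \<Phi> a b f Q}"
    by (rule best_approx_eq_minimizers[OF P(1) P_min])
  ultimately have "best_approx \<Phi> a b f S = {P}"
    using P(1) P_min by blast
  then show "is_singleton (best_approx \<Phi> a b f S)"
    by (simp add: is_singleton_def)
qed

end
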